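(* There exist a constant $c>0$ and an integer $n_0$ such that for all integers $n\ge n_0$, $$E_2(n)\geq c\,n\sqrt{\log n},\qquad M_2(n,n)\geq c\,n\sqrt{\log n},\qquad W_2(n)\geq c\,n\sqrt{\log n}.$$ That is, $E_2(n)$, $M_2(n,n)$ and $W_2(n)$ are all in $\Omega(n\sqrt{\log n})$.
   Context: A set of points in $\mathbf{R}^d$ is convexly independent if it is the vertex set of its convex hull, i.e. no point of it lies in the convex hull of the others. $E_d(n)$: for a finite set $P\subset\mathbf{R}^d$, let $E(P)$ be the maximum number of (unordered) pairs of distinct points of $P$ such that the midpoints of these pairs are convexly independent (distinct pairs selected having distinct midpoints); $E_d(n)=\max\{E(P): P\subset\mathbf{R}^d, |P|=n\}$. $M_d(m,n)$: the maximum size of a convexly independent subset of the Minkowski sum $P+Q=\{p+q: p\in P,q\in Q\}$, the maximum being over all sets $P$ of $m$ points and $Q$ of $n$ points in $\mathbf{R}^d$. $W_d(n)$: the maximum number of pairwise nonparallel segments of unit length (measured in the norm) with both endpoints in a set of $n$ points, the maximum being over all sets of $n$ points in $\mathbf{R}^d$ and all strictly convex norms on $\mathbf{R}^d$ (a norm is strictly convex if its unit sphere contains no nondegenerate line segment). *)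

theory Defs
  imports "HOL-Analysis.Analysis"
begin

definition convexly_independent :: "'a::real_vector set \<Rightarrow> bool" where
  "convexly_independent S \<longleftrightarrow> (\<forall>x\<in>S. x \<notin> convex hull (S - {x}))"

text \<open>Unordered pairs of distinct points are represented as two-element sets.\<close>

definition point_pairs :: "'a set \<Rightarrow> 'a set set" where
  "point_pairs P = {{p, q} | p q. p \<in> P \<and> q \<in> P \<and> p \<noteq> q}"

definition distinct_midpoints :: "'a::real_vector set set \<Rightarrow> bool" where
  "distinct_midpoints G \<longleftrightarrow>
     (\<forall>p q r s. {p, q} \<in> G \<and> {r, s} \<in> G \<and> midpoint p q = midpoint r s \<longrightarrow> {p, q} = {r, s})"

text \<open>
  All maxima below are taken over sets of natural numbers that are nonempty and bounded
  (by the number of pairs of points), so \<^const>\<open>Max\<close> is a genuine maximum.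
  The dimension \<open>d\<close> is the cardinality of the index type \<open>'d\<close>, passed as a type argument.
\<close>

definition E_points :: "'a::real_vector set \<Rightarrow> nat" where
  "E_points P = Max {card G | G. G \<subseteq> point_pairs P \<and> distinct_midpoints G \<and>
     convexly_independent {midpoint p q | p q. {p, q} \<in> G}}"

definition E_num :: "'d::finite itself \<Rightarrow> nat \<Rightarrow> nat" where
  "E_num _ n = Max {E_points P | P :: (real ^ 'd) set. finite P \<and> card P = n}"

definition M_num :: "'d::finite itself \<Rightarrow> nat \<Rightarrow> nat \<Rightarrow> nat" where
  "M_num _ m n = Max {card S | S (P :: (real ^ 'd) set) Q.
     finite P \<and> card P = m \<and> finite Q \<and> card Q = n \<and>
     S \<subseteq> {p + q | p q. p \<in> P \<and> q \<in> Q} \<and> convexly_independent S}"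

definition is_norm :: "('a::real_vector \<Rightarrow> real) \<Rightarrow> bool" where
  "is_norm N \<longleftrightarrow> (\<forall>x. N x \<ge> 0) \<and> (\<forall>x. N x = 0 \<longleftrightarrow> x = 0) \<and>
     (\<forall>a x. N (a *\<^sub>R x) = \<bar>a\<bar> * N x) \<and> (\<forall>x y. N (x + y) \<le> N x + N y)"

definition strictly_convex_norm :: "('a::real_vector \<Rightarrow> real) \<Rightarrow> bool" where
  "strictly_convex_norm N \<longleftrightarrow> is_norm N \<and>
     (\<forall>a b. closed_segment a b \<subseteq> {x. N x = 1} \<longrightarrow> a = b)"

definition unit_pairs :: "('a::real_vector \<Rightarrow> real) \<Rightarrow> 'a set set \<Rightarrow> bool" where
  "unit_pairs N G \<longleftrightarrow> (\<forall>p q. {p, q} \<in> G \<longrightarrow> N (p - q) = 1)"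

text \<open>Two nondegenerate segments are parallel iff their direction vectors are proportional.\<close>

definition pairwise_nonparallel :: "'a::real_vector set set \<Rightarrow> bool" where
  "pairwise_nonparallel G \<longleftrightarrow>
     (\<forall>p q r s. {p, q} \<in> G \<and> {r, s} \<in> G \<and> {p, q} \<noteq> {r, s} \<longrightarrow>
        \<not> (\<exists>a. p - q = a *\<^sub>R (r - s)))"

definition W_num :: "'d::finite itself \<Rightarrow> nat \<Rightarrow> nat" where
  "W_num _ n = Max {card G | G (P :: (real ^ 'd) set) N.
     finite P \<and> card P = n \<and> strictly_convex_norm N \<and>
     G \<subseteq> point_pairs P \<and> unit_pairs N G \<and> pairwise_nonparallel G}"

end

theory Submission
  imports Defs
begin

text \<open>
  For points \<open>(u, y)\<close> and lines of slope \<open>s\<close> and intercept \<open>z\<close>, the vectors \<open>(u, -u\<^sup>2/2 - y)\<close> and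
  \<open>(s, -s\<^sup>2/2 + z)\<close> have their sum on the parabola \<open>Y = -X\<^sup>2/2\<close> exactly when the point is on the line.
  Hence point-line configurations with many incidences give many sums in convex position, provided
  that the numbers \<open>u + s\<close> are distinct for distinct incidences. In the grid with \<open>u < k\<close>,
  \<open>s \<in> k {0..<k}\<close>, \<open>z < k\<^sup>3\<close> there are \<open>k\<^sup>5\<close> incidences on \<open>O(k\<^sup>4)\<close> points and lines; here \<open>u + s\<close>
  determines \<open>u\<close> and \<open>s\<close>, and a small horizontal shear \<open>u \<mapsto> u + \<epsilon> y\<close>, which turns the slope into
  \<open>s / (1 + \<epsilon> s)\<close>, also separates the intercepts. This gives even \<open>\<Omega>(n powr (5/4))\<close>. After an affine
  normalisation the parabola is \<open>Y = (1 - X\<^sup>2) / 2\<close>, whose part with \<open>\<bar>X\<bar> < 1\<close> is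
  the upper half of the unit circle of the strictly convex norm \<open>\<bar>Y\<bar> + sqrt (X\<^sup>2 + Y\<^sup>2)\<close>.
\<close>

section \<open>Lower bounds from pairs with distinct sums\<close>

text \<open>Pads a configuration with arbitrary further points, as the extremal numbers are defined
  for sets of exactly \<open>n\<close> points.\<close>

lemma exists_superset_card:
  assumes "infinite (UNIV :: 'a set)" "finite (A :: 'a set)" "card A \<le> n"
  obtains B where "A \<subseteq> B" "finite B" "card B = n"
proof -
  have "infinite (- A)"
    using assms(1,2) by (simp add: Compl_eq_Diff_UNIV)
  then obtain C where C: "C \<subseteq> - A" "finite C" "card C = n - card A"
    using infinite_arbitrarily_large by blast
  then have "card (A \<union> C) = n"
    using assms(2,3) by (subst card_Un_disjoint) auto
  then show thesis
    using that[of "A \<union> C"] C(2) assms(2) by auto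
qed

section \<open>Finiteness of the sets of attained cardinalities\<close>

lemma point_pairs_subset_Pow: "point_pairs P \<subseteq> Pow P"
  unfolding point_pairs_def by auto

lemma card_point_pairs_le:
  assumes "finite P" "G \<subseteq> point_pairs P"
  shows "card G \<le> 2 ^ card P"
  using assms point_pairs_subset_Pow[of P] card_mono[of "Pow P" G]
  by (metis card_Pow finite_Pow_iff order_trans)

lemma finite_E_points_set:
  assumes "finite P"
  shows "finite {card G | G. G \<subseteq> point_pairs P \<and> distinct_midpoints G \<and>
     convexly_independent {midpoint p q | p q. {p, q} \<in> G}}"
  by (rule finite_subset[of _ "{..2 ^ card P}"]) (use card_point_pairs_le[OF assms] in auto)

lemma E_points_ge:
  assumes "finite P" "G \<subseteq> point_pairs P" "distinct_midpoints G"
    "convexly_independent {midpoint p q | p q. {p, q} \<in> G}"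
  shows "card G \<le> E_points P"
  unfolding E_points_def
  by (rule Max_ge[OF finite_E_points_set[OF assms(1)]]) (use assms in blast)

text \<open>A bound in terms of \<open>card P\<close> alone, so that the maximum defining
  \<open>E_num\<close> ranges over a finite set.\<close>

lemma E_points_le:
  assumes "finite P"
  shows "E_points P \<le> 2 ^ card P"
proof -
  have "distinct_midpoints ({} :: 'a set set)"
    "convexly_independent {midpoint p q | p q :: 'a. {p, q} \<in> {}}"
    unfolding distinct_midpoints_def convexly_independent_def by auto
  then have "{card G | G. G \<subseteq> point_pairs P \<and> distinct_midpoints G \<and>
     convexly_independent {midpoint p q | p q. {p, q} \<in> G}} \<noteq> {}"
    by blast
  then show ?thesis
    unfolding E_points_def
    by (subst Max_le_iff[OF finite_E_points_set[OF assms]])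
      (use card_point_pairs_le[OF assms] in auto)
qed

lemma E_points_le_E_num:
  assumes "finite (P :: (real ^ 'd) set)" "card P = n"
  shows "E_points P \<le> E_num TYPE('d) n"
proof -
  have "finite {E_points P | P :: (real ^ 'd) set. finite P \<and> card P = n}"
    by (rule finite_subset[of _ "{..2 ^ n}"]) (use E_points_le in auto)
  then show ?thesis
    unfolding E_num_def by (rule Max_ge) (use assms in blast)
qed

text \<open>Used with \<open>c = 1/2\<close>, since midpoints are halves of sums.\<close>

lemma convexly_independent_scaleR:
  assumes "convexly_independent S" "c \<noteq> 0"
  shows "convexly_independent ((\<lambda>x. c *\<^sub>R x) ` S)"
  unfolding convexly_independent_def
proof (rule ballI)
  fix x assume "x \<in> (\<lambda>x. c *\<^sub>R x) ` S"
  then obtain s where s: "s \<in> S" "x = c *\<^sub>R s"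
    by auto
  have "(\<lambda>x. c *\<^sub>R x) ` S - {x} = (\<lambda>x. c *\<^sub>R x) ` (S - {s})"
    using s assms(2) by auto
  then show "x \<notin> convex hull ((\<lambda>x. c *\<^sub>R x) ` S - {x})"
    using s assms by (auto simp: convex_hull_scaling convexly_independent_def)
qed

text \<open>The pairs \<open>{p, q}\<close> are drawn from \<open>P \<union> Q\<close>. Disjointness
  keeps \<open>p\<close> and \<open>q\<close> distinct and lets the unordered pair determine
  \<open>(p, q)\<close>.\<close>

lemma E_num_ge:
  fixes P Q :: "(real ^ 'd) set"
  assumes fin: "finite P" "finite Q" and "P \<inter> Q = {}" and card: "card P + card Q \<le> n"
    and I: "I \<subseteq> P \<times> Q" and inj: "inj_on (\<lambda>(p, q). p + q) I"
    and conv: "convexly_independent ((\<lambda>(p, q). p + q) ` I)"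
  shows "card I \<le> E_num TYPE('d) n"
proof -
  have "finite (P \<union> Q)" "card (P \<union> Q) \<le> n"
    using fin card card_Un_le[of P Q] by auto
  then obtain B where B: "P \<union> Q \<subseteq> B" "finite B" "card B = n"
    using exists_superset_card[OF infinite_UNIV_vec[OF infinite_UNIV_char_0]] by metis
  define G where "G = (\<lambda>(p, q). {p, q}) ` I"
  \<comment> \<open>An unordered pair in \<open>G\<close> does not tell which element comes from
    \<open>P\<close>; the sum, being symmetric, is recovered all the same.\<close>
  have G: "\<exists>(r, s)\<in>I. {p, q} = {r, s} \<and> p + q = r + s" if "{p, q} \<in> G" for p q
    using that unfolding G_def by (force simp: doubleton_eq_iff add.commute)
  have mid: "midpoint p q = midpoint r s \<longleftrightarrow> p + q = r + s" for p q r s :: "real ^ 'd"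
    by (simp add: midpoint_def)
  have "inj_on (\<lambda>(p, q). {p, q}) I"
  proof (rule inj_onI, clarify)
    fix p q r s assume "(p, q) \<in> I" "(r, s) \<in> I" "{p, q} = {r, s}"
    then show "p = r \<and> q = s"
      using I \<open>P \<inter> Q = {}\<close> by (auto simp: doubleton_eq_iff)
  qed
  then have "card G = card I"
    unfolding G_def by (rule card_image)
  moreover have "G \<subseteq> point_pairs B"
  proof
    fix g assume "g \<in> G"
    then obtain p q where pq: "(p, q) \<in> I" "g = {p, q}"
      unfolding G_def by auto
    then have "p \<in> B" "q \<in> B" "p \<noteq> q"
      using I B(1) \<open>P \<inter> Q = {}\<close> by auto
    then show "g \<in> point_pairs B"
      unfolding point_pairs_def pq(2) by blast
  qed
  moreover have "distinct_midpoints G"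
    unfolding distinct_midpoints_def mid
  proof (intro allI impI)
    fix p q r s assume *: "{p, q} \<in> G \<and> {r, s} \<in> G \<and> p + q = r + s"
    obtain p1 q1 where 1: "(p1, q1) \<in> I" "{p, q} = {p1, q1}" "p + q = p1 + q1"
      using G[of p q] * by auto
    obtain r1 s1 where 2: "(r1, s1) \<in> I" "{r, s} = {r1, s1}" "r + s = r1 + s1"
      using G[of r s] * by auto
    have "(p1, q1) = (r1, s1)"
      using inj_onD[OF inj, of "(p1, q1)" "(r1, s1)"] 1 2 * by auto
    then show "{p, q} = {r, s}"
      using 1(2) 2(2) by simp
  qed
  moreover have "{midpoint p q | p q. {p, q} \<in> G} =
      (\<lambda>x. (1/2) *\<^sub>R x) ` ((\<lambda>(p, q). p + q) ` I)" (is "?L = ?R")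
  proof
    show "?L \<subseteq> ?R"
    proof clarify
      fix p q assume "{p, q} \<in> G"
      then obtain r s where "(r, s) \<in> I" "p + q = r + s"
        using G[of p q] by auto
      then show "midpoint p q \<in> ?R"
        by (auto simp: midpoint_def intro!: imageI rev_image_eqI[of "(r, s)"])
    qed
    show "?R \<subseteq> ?L"
    proof clarify
      fix p q assume "(p, q) \<in> I"
      then have "{p, q} \<in> G"
        unfolding G_def by auto
      then show "\<exists>r s. (1/2) *\<^sub>R (p + q) = midpoint r s \<and> {r, s} \<in> G"
        by (intro exI[of _ p] exI[of _ q]) (simp add: midpoint_def)
    qed
  qed
  ultimately have "card I \<le> E_points B"
    using E_points_ge[OF B(2), of G] convexly_independent_scaleR[OF conv, of "1/2"] by simp
  then show ?thesis
    using E_points_le_E_num[OF B(2,3)] by simp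
qed

lemma M_num_ge:
  fixes P Q :: "(real ^ 'd) set"
  assumes fin: "finite P" "finite Q" and card: "card P \<le> m" "card Q \<le> n"
    and I: "I \<subseteq> P \<times> Q" and inj: "inj_on (\<lambda>(p, q). p + q) I"
    and conv: "convexly_independent ((\<lambda>(p, q). p + q) ` I)"
  shows "card I \<le> M_num TYPE('d) m n"
proof -
  obtain A where A: "P \<subseteq> A" "finite A" "card A = m"
    using exists_superset_card[OF infinite_UNIV_vec[OF infinite_UNIV_char_0] fin(1) card(1)] by metis
  obtain B where B: "Q \<subseteq> B" "finite B" "card B = n"
    using exists_superset_card[OF infinite_UNIV_vec[OF infinite_UNIV_char_0] fin(2) card(2)] by metis
  let ?M = "{card S | S (P :: (real ^ 'd) set) Q.
     finite P \<and> card P = m \<and> finite Q \<and> card Q = n \<and>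
     S \<subseteq> {p + q | p q. p \<in> P \<and> q \<in> Q} \<and> convexly_independent S}"
  have "?M \<subseteq> {..m * n}"
  proof
    fix x assume "x \<in> ?M"
    then obtain S P and Q :: "(real ^ 'd) set" where S: "x = card S" "finite P" "card P = m"
      "finite Q" "card Q = n" "S \<subseteq> {p + q | p q. p \<in> P \<and> q \<in> Q}"
      by (elim CollectE exE conjE) (rule that)
    have "S \<subseteq> (\<lambda>(p, q). p + q) ` (P \<times> Q)"
      using S(6) by auto
    then have "card S \<le> card (P \<times> Q)"
      using S(2,4) by (intro surj_card_le) auto
    then show "x \<in> {..m * n}"
      using S(1,3,5) by (simp add: card_cartesian_product)
  qed
  then have "finite ?M"
    by (rule finite_subset) simp
  moreover have "(\<lambda>(p, q). p + q) ` I \<subseteq> {p + q | p q. p \<in> A \<and> q \<in> B}"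
    using I A(1) B(1) by fast
  then have "card ((\<lambda>(p, q). p + q) ` I) \<in> ?M"
    by (intro CollectI exI[of _ "(\<lambda>(p, q). p + q) ` I"] exI[of _ A] exI[of _ B] conjI refl A B conv)
  ultimately have "card ((\<lambda>(p, q). p + q) ` I) \<le> M_num TYPE('d) m n"
    unfolding M_num_def by (rule Max_ge)
  then show ?thesis
    by (simp add: card_image[OF inj])
qed

text \<open>\<open>p + q\<close> is the difference vector of the points \<open>p\<close> and
  \<open>- q\<close>, so the point set is \<open>P\<close> together with the negatives of
  \<open>Q\<close>. Parallel unit segments have equal or opposite difference vectors; injectivity
  and the absence of antipodal sums exclude both.\<close>

lemma W_num_ge:
  fixes P Q :: "(real ^ 'd) set"
  assumes fin: "finite P" "finite Q" and card: "card P + card Q \<le> n"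
    and I: "I \<subseteq> P \<times> Q" and inj: "inj_on (\<lambda>(p, q). p + q) I"
    and N: "strictly_convex_norm N" "\<And>p q. (p, q) \<in> I \<Longrightarrow> N (p + q) = 1"
    and no_antipodes: "\<And>p q r s. (p, q) \<in> I \<Longrightarrow> (r, s) \<in> I \<Longrightarrow> p + q \<noteq> - (r + s)"
  shows "card I \<le> W_num TYPE('d) n"
proof -
  let ?W = "{card G | G (P :: (real ^ 'd) set) N.
     finite P \<and> card P = n \<and> strictly_convex_norm N \<and>
     G \<subseteq> point_pairs P \<and> unit_pairs N G \<and> pairwise_nonparallel G}"
  have norm: "is_norm N"
    using N(1) unfolding strictly_convex_norm_def by simp
  then have Nabs: "N (a *\<^sub>R x) = \<bar>a\<bar> * N x" for a x
    unfolding is_norm_def by simp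
  have Nminus: "N (- x) = N x" for x
    using Nabs[of "-1" x] by simp
  have N0: "N 0 = 0"
    using Nabs[of 0 0] by simp
  have "finite (P \<union> uminus ` Q)" "card (P \<union> uminus ` Q) \<le> n"
    using fin card card_Un_le[of P "uminus ` Q"] card_image_le[OF fin(2), of uminus] by auto
  then obtain B where B: "P \<union> uminus ` Q \<subseteq> B" "finite B" "card B = n"
    using exists_superset_card[OF infinite_UNIV_vec[OF infinite_UNIV_char_0]] by metis
  define G where "G = (\<lambda>(p, q). {p, - q}) ` I"
  have G: "\<exists>(r, s)\<in>I. {p, q} = {r, - s} \<and> (p - q = r + s \<or> p - q = - (r + s))"
    if "{p, q} \<in> G" for p q
    using that unfolding G_def by (force simp: doubleton_eq_iff)
  have "inj_on (\<lambda>(p, q). {p, - q}) I"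
  proof (rule inj_onI, clarify)
    fix p q r s assume *: "(p, q) \<in> I" "(r, s) \<in> I" "{p, - q} = {r, - s}"
    \<comment> \<open>Matching crosswise, \<open>p = - s\<close> and \<open>- q = r\<close>, makes
      the two sums antipodal.\<close>
    then have "p = r \<and> q = s \<or> p + q = - (r + s)"
      by (auto simp: doubleton_eq_iff algebra_simps)
    then show "p = r \<and> q = s"
      using no_antipodes * by blast
  qed
  then have "card G = card I"
    unfolding G_def by (rule card_image)
  moreover have "G \<subseteq> point_pairs B"
  proof
    fix g assume "g \<in> G"
    then obtain p q where pq: "(p, q) \<in> I" "g = {p, - q}"
      unfolding G_def by auto
    then have "p + q \<noteq> 0"
      using N(2) N0 by fastforce
    then have "p \<noteq> - q"
      by (simp add: eq_neg_iff_add_eq_0)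
    moreover have "p \<in> B" "- q \<in> B"
      using pq I B(1) by auto
    ultimately show "g \<in> point_pairs B"
      unfolding point_pairs_def pq(2) by blast
  qed
  moreover have "unit_pairs N G"
    unfolding unit_pairs_def
  proof (intro allI impI)
    fix p q assume "{p, q} \<in> G"
    then obtain r s where "(r, s) \<in> I" "p - q = r + s \<or> p - q = - (r + s)"
      using G[of p q] by auto
    then show "N (p - q) = 1"
      using N(2) Nminus by metis
  qed
  moreover have "pairwise_nonparallel G"
    unfolding pairwise_nonparallel_def
  proof (intro allI impI notI, elim conjE exE)
    fix p q r s a assume *: "{p, q} \<in> G" "{r, s} \<in> G" "{p, q} \<noteq> {r, s}" "p - q = a *\<^sub>R (r - s)"
    obtain p1 q1 where 1: "(p1, q1) \<in> I" "{p, q} = {p1, - q1}"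
      "p - q = p1 + q1 \<or> p - q = - (p1 + q1)"
      using G[OF *(1)] by auto
    obtain r1 s1 where 2: "(r1, s1) \<in> I" "{r, s} = {r1, - s1}"
      "r - s = r1 + s1 \<or> r - s = - (r1 + s1)"
      using G[OF *(2)] by auto
    have "N (p - q) = 1" "N (r - s) = 1"
      using 1 2 N(2) Nminus by metis+
    then have "\<bar>a\<bar> = 1"
      using *(4) Nabs by simp
    then have "p - q = r - s \<or> p - q = - (r - s)"
      using *(4) by (auto simp: abs_if split: if_splits)
    then have "p1 + q1 = r1 + s1 \<or> p1 + q1 = - (r1 + s1)"
      using 1(3) 2(3) by (metis minus_minus)
    then have "(p1, q1) = (r1, s1)"
      using no_antipodes[OF 1(1) 2(1)] inj 1(1) 2(1) by (auto simp: inj_on_def)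
    then show False
      using *(3) 1(2) 2(2) by simp
  qed
  ultimately have "card G \<in> ?W"
    using B(2,3) N(1) by blast
  moreover have "?W \<subseteq> {..2 ^ n}"
    using card_point_pairs_le by blast
  then have "finite ?W"
    by (rule finite_subset) simp
  ultimately have "card G \<le> W_num TYPE('d) n"
    unfolding W_num_def by (intro Max_ge)
  then show ?thesis
    by (simp add: \<open>card G = card I\<close>)
qed

section \<open>The parabola\<close>

text \<open>Strict concavity puts every other point strictly below the tangent at \<open>x\<close>,
  and the open half-plane there is convex but misses \<open>x\<close>.\<close>

lemma convexly_independent_parabola:
  fixes S :: "(real ^ 2) set"
  assumes "\<And>v. v \<in> S \<Longrightarrow> v $ 2 = a - b * (v $ 1)\<^sup>2" "b > 0"
  shows "convexly_independent S"
  unfolding convexly_independent_def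
proof (rule ballI, rule notI)
  fix x assume x: "x \<in> S" "x \<in> convex hull (S - {x})"
  \<comment> \<open>the open half-plane below the tangent at \<open>x\<close>\<close>
  define H where "H = {v :: real ^ 2. vector [2 * b * (x $ 1), 1] \<bullet> v < a + b * (x $ 1)\<^sup>2}"
  have H: "v \<in> H \<longleftrightarrow> 2 * b * (x $ 1) * (v $ 1) + v $ 2 < a + b * (x $ 1)\<^sup>2" for v
    unfolding H_def by (simp add: inner_vec_def sum_2)
  have "S - {x} \<subseteq> H"
  proof
    fix v assume v: "v \<in> S - {x}"
    then have "v $ 1 \<noteq> x $ 1"
      using assms(1)[of v] assms(1)[of x] x(1) by (auto simp: vec_eq_iff forall_2)
    \<comment> \<open>This is the vertical distance from \<open>v\<close> up to the tangent at
      \<open>x\<close>.\<close>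
    then have "b * (v $ 1 - x $ 1)\<^sup>2 > 0"
      using assms(2) by simp
    then show "v \<in> H"
      using assms(1)[of v] v unfolding H by (simp add: power2_eq_square algebra_simps)
  qed
  moreover have "convex H"
    unfolding H_def by (rule convex_halfspace_lt)
  ultimately have "x \<in> H"
    using x(2) hull_minimal[of "S - {x}" H convex] by auto
  then show False
    using assms(1)[OF x(1)] unfolding H by (simp add: power2_eq_square algebra_simps)
qed

text \<open>The unit circle consists of two parabolic arcs with focus at the origin and directrices
  \<open>Y = 1\<close> and \<open>Y = -1\<close>.\<close>

definition parabolic_norm :: "real ^ 2 \<Rightarrow> real" where
  "parabolic_norm v = \<bar>v $ 2\<bar> + norm v"

text \<open>Inherited from the Euclidean summand: equality in the triangle inequality for the whole
  norm forces it in each summand, so \<open>a\<close> and \<open>b\<close> lie on one ray.\<close>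

lemma strictly_convex_parabolic_norm: "strictly_convex_norm parabolic_norm"
  unfolding strictly_convex_norm_def
proof (intro conjI allI impI)
  have "parabolic_norm (x + y) \<le> parabolic_norm x + parabolic_norm y" for x y
    unfolding parabolic_norm_def using norm_triangle_ineq[of x y] by simp
  moreover have "parabolic_norm x = 0 \<longleftrightarrow> x = 0" for x
    unfolding parabolic_norm_def by (auto simp: add_nonneg_eq_0_iff)
  ultimately show "is_norm parabolic_norm"
    unfolding is_norm_def by (auto simp: parabolic_norm_def abs_mult algebra_simps)
next
  fix a b assume *: "closed_segment a b \<subseteq> {x. parabolic_norm x = 1}"
  have ab: "parabolic_norm a = 1" "parabolic_norm b = 1" "parabolic_norm (midpoint a b) = 1"
    using * midpoint_in_closed_segment[of a b] by (auto simp del: midpoint_in_closed_segment)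
  have scale: "parabolic_norm (c *\<^sub>R x) = \<bar>c\<bar> * parabolic_norm x" for c x
    by (simp add: parabolic_norm_def abs_mult algebra_simps)
  have "parabolic_norm (a + b) = parabolic_norm a + parabolic_norm b"
    using ab scale[of "1/2" "a + b"] by (simp add: midpoint_def)
  then have "norm (a + b) = norm a + norm b"
    using norm_triangle_ineq[of a b] abs_triangle_ineq[of "a $ 2" "b $ 2"]
    unfolding parabolic_norm_def by simp
  then have eq: "norm a *\<^sub>R b = norm b *\<^sub>R a"
    by (simp add: norm_triangle_eq)
  then have "norm b = norm a"
    using ab scale[of "norm a" b] scale[of "norm b" a] by simp
  moreover have "a \<noteq> 0"
    using ab(1) by (auto simp: parabolic_norm_def)
  ultimately show "a = b"
    using eq by simp
qed

lemma parabolic_norm_eq_1: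
  assumes "v $ 2 = (1 - (v $ 1)\<^sup>2) / 2" "\<bar>v $ 1\<bar> < 1"
  shows "parabolic_norm v = 1"
proof -
  have "(v $ 1)\<^sup>2 < 1"
    using assms(2) by (simp add: abs_square_less_1)
  then have "0 < v $ 2"
    using assms(1) by simp
  have "(1 - t) / 2 \<le> 1" if "0 \<le> t" for t :: real
    using that by simp
  then have "v $ 2 \<le> 1"
    by (simp only: assms(1) zero_le_power2)
  \<comment> \<open>Focus-directrix property: the distance to the origin equals the distance to the
    line \<open>Y = 1\<close>.\<close>
  have "(norm v)\<^sup>2 = (1 - v $ 2)\<^sup>2"
    using assms(1) by (simp add: norm_vec_def L2_set_def sum_2 power2_eq_square field_simps)
  then have "norm v = 1 - v $ 2"
    using \<open>v $ 2 \<le> 1\<close> by (subst (asm) power2_eq_iff_nonneg) auto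
  then show ?thesis
    using \<open>0 < v $ 2\<close> by (simp add: parabolic_norm_def)
qed

section \<open>The sheared grid\<close>

text \<open>Up to a fixed offset, \<open>X\<close> stays so close to the integer
  \<open>u + k * m\<close> that it determines this integer, whose base-\<open>k\<close> digits are
  \<open>u\<close> and \<open>m\<close>. What remains is the term linear in
  \<open>y\<close>.\<close>

lemma sheared_sums_inj:
  fixes k u m y u' m' y' :: nat
  defines "X \<equiv> \<lambda>u m y. real u + real y / (4 * real k ^ 4) + real (k * m) / (1 + real (k * m) / (4 * real k ^ 4))"
  assumes "u < k" "m < k" "y < 2 * k ^ 3" "u' < k" "m' < k" "y' < 2 * k ^ 3"
    and eq: "X u m y = X u' m' y'"
  shows "u = u' \<and> m = m' \<and> y = y'"
proof -
  have k: "k > 0"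
    using assms by simp
  \<comment> \<open>The amount by which a shear of strength \<open>1 / K\<close> lowers the slope
    \<open>s\<close>.\<close>
  have shear: "s - s / (1 + s / K) = s\<^sup>2 / (K + s)" if "s \<ge> 0" "K > 0" for s K :: real
    using that by (simp add: divide_simps power2_eq_square add_pos_nonneg) (simp add: algebra_simps)
  \<comment> \<open>The term in \<open>y\<close> adds between 0 and 1/2, the lowered slope subtracts
    between 0 and 1/4; the offset 1/8 centres this range.\<close>
  have near: "\<bar>X u m y - (real (u + k * m) + 1/8)\<bar> < 1/2" if "m < k" "y < 2 * k ^ 3" for u m y
  proof -
    let ?s = "real (k * m)" and ?K = "4 * real k ^ 4"
    have K: "?K > 0"
      using k by simp
    have "real y < 2 * real k ^ 3"
      using that(2) of_nat_less_iff[of y "2 * k ^ 3", where ?'a = real] by simp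
    moreover have "real k ^ 3 \<le> real k ^ 4"
      using k by (intro power_increasing) auto
    ultimately have y: "real y / ?K < 1/2"
      using K by (simp add: field_simps)
    have "k * m \<le> k * k"
      using that(1) by simp
    then have "?s \<le> real k ^ 2"
      using of_nat_le_iff[of "k * m" "k * k", where ?'a = real] by (simp add: power2_eq_square)
    then have "?s ^ 2 \<le> (real k ^ 2) ^ 2"
      by (intro power_mono) auto
    then have s2: "?s ^ 2 \<le> real k ^ 4"
      by simp
    have "?s - ?s / (1 + ?s / ?K) = ?s ^ 2 / (?K + ?s)"
      using K by (intro shear) simp_all
    moreover have "\<dots> \<le> 1/4"
      using K s2 by (subst pos_divide_le_eq) (simp_all add: add_pos_nonneg del: of_nat_mult)
    moreover have "0 \<le> ?s ^ 2 / (?K + ?s)"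
      by simp
    moreover have "0 \<le> real y / ?K"
      by simp
    ultimately show ?thesis
      using y unfolding X_def abs_less_iff of_nat_add by linarith
  qed
  have "\<bar>real (u + k * m) - real (u' + k * m')\<bar> < 1"
    using near[of m y u] near[of m' y' u'] assms(3,4,6,7) eq unfolding abs_less_iff by linarith
  then have "u + k * m = u' + k * m'"
    by linarith
  then have "(u + k * m) mod k = (u' + k * m') mod k" "(u + k * m) div k = (u' + k * m') div k"
    by simp_all
  then have "u = u'" "m = m'"
    using assms by simp_all
  moreover from this have "y = y'"
    using eq k by (simp add: X_def)
  ultimately show ?thesis
    by simp
qed

lemma sheared_grid:
  fixes k :: nat
  assumes k: "k > 0"
  obtains P Q :: "(real ^ 2) set" and I
  where "finite P" "finite Q" "P \<inter> Q = {}" "card P + card Q \<le> 4 * k ^ 4" "I \<subseteq> P \<times> Q" "card I = k ^ 5"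
    "inj_on (\<lambda>(p, q). p + q) I"
    "\<forall>(p, q)\<in>I. (p + q) $ 2 = (1 - ((p + q) $ 1)\<^sup>2) / 2 \<and> \<bar>(p + q) $ 1\<bar> < 1"
proof -
  \<comment> \<open>\<open>e\<close> is the strength of the shear, as in
    \<open>sheared_sums_inj\<close>. The sums \<open>U u y + V m\<close> stay below
    \<open>3 * k ^ 2\<close>, so division by \<open>R\<close> makes them less than 1.\<close>
  define e R where "e = 1 / (4 * real k ^ 4)" and "R = 4 * real k ^ 2"
  have e: "e > 0" and R: "R > 0"
    using k by (simp_all add: e_def R_def)
  \<comment> \<open>Abscissa of a sheared point and slope of a sheared line: solving
    \<open>y = s * (x - e * y) + z\<close> for \<open>y\<close>, with \<open>s = k * m\<close>,
    gives slope \<open>s / (1 + e * s)\<close> and the intercept \<open>z / (1 + e * s)\<close> that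
    enters \<open>q\<close>.\<close>
  define U V where "U = (\<lambda>u y :: nat. real u + e * real y)"
    and "V = (\<lambda>m :: nat. real (k * m) / (1 + e * real (k * m)))"
  \<comment> \<open>The opposite horizontal translations by 5 make the two point sets disjoint.\<close>
  define p :: "nat \<times> nat \<Rightarrow> real ^ 2" where
    "p = (\<lambda>(u, y). vector [U u y / R + 5, 1/2 - ((U u y)\<^sup>2 / 2 + real y) / R\<^sup>2])"
  define q :: "nat \<times> nat \<Rightarrow> real ^ 2" where
    "q = (\<lambda>(m, z). vector [V m / R - 5, (real z / (1 + e * real (k * m)) - (V m)\<^sup>2 / 2) / R\<^sup>2])"
  \<comment> \<open>A point on a line has height \<open>u * (k * m) + z\<close>, which is below
    \<open>k ^ 3 + k ^ 3\<close>; hence twice as many heights as intercepts.\<close>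
  define P Q where "P = p ` ({..<k} \<times> {..<2 * k ^ 3})" and "Q = q ` ({..<k} \<times> {..<k ^ 3})"
  \<comment> \<open>An incidence is encoded by a line \<open>(m, z)\<close> and the abscissa
    \<open>u\<close> of a point on it before the shear.\<close>
  define J where "J = {..<k} \<times> {..<k} \<times> {..<k ^ 3}"
  define f where "f = (\<lambda>(u, m, z). (p (u, u * (k * m) + z), q (m, z)))"
  define g where "g = (\<lambda>(p :: real ^ 2, q). p + q)"
  have y_less: "u * (k * m) + z < 2 * k ^ 3" if "(u, m, z) \<in> J" for u m z
  proof -
    have "u * (k * m) \<le> k ^ 3"
      unfolding power3_eq_cube mult.assoc using that by (intro mult_mono) (auto simp: J_def)
    moreover have "z < k ^ 3"
      using that by (simp add: J_def)
    ultimately show ?thesis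
      by linarith
  qed
  have U_less: "0 \<le> U u y \<and> U u y < 2 * real k ^ 2" if "u < k" "y < 2 * k ^ 3" for u y
  proof -
    have "real y < 2 * real k ^ 3"
      using that(2) of_nat_less_iff[of y "2 * k ^ 3", where ?'a = real] by simp
    moreover have "real k ^ 3 \<le> real k ^ 4" "real k \<le> real k ^ 2" "real u + 1 \<le> real k" "1 \<le> real k"
      using k that(1) power_increasing[of 3 4 "real k"] self_le_power[of "real k" 2] by auto
    ultimately have "e * real y < 1/2"
      using k by (simp add: e_def field_simps)
    moreover have "0 \<le> e * real y"
      using e by simp
    ultimately show ?thesis
      using \<open>real k \<le> real k ^ 2\<close> \<open>real u + 1 \<le> real k\<close> unfolding U_def by linarith
  qed
  have V_le: "0 \<le> V m \<and> V m \<le> real k ^ 2" if "m < k" for m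
  proof -
    have "V m \<le> real (k * m)"
      using divide_left_mono[of 1 "1 + e * real (k * m)" "real (k * m)"] e
      unfolding V_def by (simp add: add_pos_nonneg)
    also have "\<dots> \<le> real (k * k)"
      using that by (subst of_nat_le_iff) simp
    finally show ?thesis
      using e unfolding V_def by (simp add: power2_eq_square)
  qed
  have sum1: "(p (u, y) + q (m, z)) $ 1 = (U u y + V m) / R" for u y m z
    by (simp add: p_def q_def add_divide_distrib)
  \<comment> \<open>The sheared point lies on the sheared line.\<close>
  have incidence: "real y = U u y * V m + real z / (1 + e * real (k * m))"
    if "y = u * (k * m) + z" for u y m z
  proof -
    have pos: "1 + e * real (k * m) > 0"
      using e by (simp add: add_pos_nonneg)
    have "(U u y * V m + real z / (1 + e * real (k * m))) * (1 + e * real (k * m)) =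
        U u y * real (k * m) + real z"
      unfolding V_def using pos by (simp add: distrib_right)
    also have "\<dots> = real y * (1 + e * real (k * m))"
      by (simp add: U_def that algebra_simps)
    finally show ?thesis
      using pos by simp
  qed
  \<comment> \<open>By \<open>incidence\<close>, height minus intercept is
    \<open>U u y * V m\<close>, the mixed term that completes the square of
    \<open>U u y + V m\<close>.\<close>
  have sum2: "(p (u, y) + q (m, z)) $ 2 = (1 - ((U u y + V m) / R)\<^sup>2) / 2"
    if "y = u * (k * m) + z" for u y m z
    using R by (simp add: p_def q_def incidence[OF that] power2_eq_square field_simps)
  \<comment> \<open>First coordinates alone separate the sums. Injectivity of the composition yields
    that of \<open>f\<close>, which counts the incidences, and that of addition on the resulting
    pairs.\<close>
  have "inj_on (g \<circ> f) J"
  proof (rule inj_onI)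
    fix a b assume ab: "a \<in> J" "b \<in> J" "(g \<circ> f) a = (g \<circ> f) b"
    obtain u m z u' m' z' where eqs: "a = (u, m, z)" "b = (u', m', z')"
      by (metis prod.exhaust)
    define y y' where "y = u * (k * m) + z" and "y' = u' * (k * m') + z'"
    have "p (u, y) + q (m, z) = p (u', y') + q (m', z')"
      using ab(3) by (simp add: eqs f_def g_def y_def y'_def)
    then have "(U u y + V m) / R = (U u' y' + V m') / R"
      by (metis sum1)
    then have "U u y + V m = U u' y' + V m'"
      using R by simp
    moreover have "u < k" "m < k" "y < 2 * k ^ 3" "u' < k" "m' < k" "y' < 2 * k ^ 3"
      using ab(1,2) y_less unfolding y_def y'_def eqs by (auto simp: J_def)
    ultimately have "u = u' \<and> m = m' \<and> y = y'"
      by (intro sheared_sums_inj[of u k m y u' m' y']) (simp_all add: U_def V_def e_def)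
    then show "a = b"
      by (auto simp: eqs y_def y'_def)
  qed
  then have inj: "inj_on f J" "inj_on g (f ` J)"
    by (auto dest: inj_on_imageI2 inj_on_imageI)
  show thesis
  proof
    show "finite P" "finite Q"
      by (simp_all add: P_def Q_def)
    have "v $ 1 > 0" if "v \<in> P" for v
      using that U_less R by (auto simp: P_def p_def intro!: add_nonneg_pos)
    moreover have "v $ 1 < 0" if vQ: "v \<in> Q" for v
    proof -
      obtain m z where v: "m < k" "v = q (m, z)"
        using vQ by (auto simp: Q_def)
      have "V m \<le> R"
        using V_le[OF v(1)] by (simp add: R_def)
      then show ?thesis
        using R by (simp add: v(2) q_def field_simps)
    qed
    ultimately show "P \<inter> Q = {}"
      by fastforce
    have "card P \<le> 2 * k ^ 4"
      using card_image_le[of "{..<k} \<times> {..<2 * k ^ 3}" p]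
      by (simp add: P_def card_cartesian_product eval_nat_numeral ac_simps)
    moreover have "card Q \<le> k ^ 4"
      using card_image_le[of "{..<k} \<times> {..<k ^ 3}" q]
      by (simp add: Q_def card_cartesian_product eval_nat_numeral ac_simps)
    ultimately show "card P + card Q \<le> 4 * k ^ 4"
      by simp
    show "f ` J \<subseteq> P \<times> Q"
      using y_less by (force simp: f_def J_def P_def Q_def)
    show "card (f ` J) = k ^ 5"
      unfolding card_image[OF inj(1)] by (simp add: J_def card_cartesian_product eval_nat_numeral)
    show "inj_on (\<lambda>(p, q). p + q) (f ` J)"
      using inj(2) unfolding g_def .
    have "(a + b) $ 2 = (1 - ((a + b) $ 1)\<^sup>2) / 2 \<and> \<bar>(a + b) $ 1\<bar> < 1"
      if abJ: "(a, b) \<in> f ` J" for a b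
    proof -
      obtain u m z where J: "(u, m, z) \<in> J"
        and ab: "a = p (u, u * (k * m) + z)" "b = q (m, z)"
        using abJ by (auto simp: f_def)
      have "u < k" "m < k"
        using J by (auto simp: J_def)
      then have "\<bar>(a + b) $ 1\<bar> < 1"
        using U_less[OF _ y_less[OF J], of u] V_le[of m] k unfolding ab sum1 by (simp add: R_def)
      moreover have "(a + b) $ 2 = (1 - ((a + b) $ 1)\<^sup>2) / 2"
        unfolding ab sum1 by (rule sum2) simp
      ultimately show ?thesis
        by simp
    qed
    then show "\<forall>(p, q)\<in>f ` J. (p + q) $ 2 = (1 - ((p + q) $ 1)\<^sup>2) / 2 \<and> \<bar>(p + q) $ 1\<bar> < 1"
      by blast
  qed
qed

section \<open>Choice of the grid size for given \<open>n\<close>, and comparison of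
  \<open>k ^ 5\<close> with the bound\<close>

theorem theorem5:
  "\<exists>c::real. c > 0 \<and> (\<exists>n0::nat. \<forall>n\<ge>n0.
     real (E_num TYPE(2) n) \<ge> c * real n * sqrt (ln (real n)) \<and>
     real (M_num TYPE(2) n n) \<ge> c * real n * sqrt (ln (real n)) \<and>
     real (W_num TYPE(2) n) \<ge> c * real n * sqrt (ln (real n)))"
proof (intro exI conjI allI impI)
  \<comment> \<open>256 is the product of the factors in \<open>n \<le> 64 * k ^ 4\<close> and
    \<open>sqrt (ln n) \<le> 4 * k\<close>.\<close>
  show "(0::real) < 1/256"
    by simp
  fix n :: nat assume n: "4 \<le> n"
  \<comment> \<open>The largest grid whose size bound \<open>4 * k ^ 4\<close> stays within
    \<open>n\<close>; it is nonempty because \<open>n\<close> is at least 4.\<close>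
  obtain k :: nat where k: "4 * k ^ 4 \<le> n" "n < 4 * Suc k ^ 4"
  proof -
    have "n < 4 * n ^ 4"
      using n self_le_power[of n 4] by linarith
    moreover have "\<not> n < 4 * 0 ^ 4"
      by simp
    ultimately obtain k where "\<not> n < 4 * k ^ 4" "n < 4 * Suc k ^ 4"
      using ex_least_nat_less[of "\<lambda>k. n < 4 * k ^ 4" n] by auto
    then show thesis
      by (intro that) auto
  qed
  have "k > 0"
    using k(2) n by (cases k) auto
  obtain P Q :: "(real ^ 2) set" and I
    where PQ: "finite P" "finite Q" "P \<inter> Q = {}" "card P + card Q \<le> 4 * k ^ 4"
      and I: "I \<subseteq> P \<times> Q" "card I = k ^ 5" "inj_on (\<lambda>(p, q). p + q) I"
      and sums: "\<forall>(p, q)\<in>I. (p + q) $ 2 = (1 - ((p + q) $ 1)\<^sup>2) / 2 \<and> \<bar>(p + q) $ 1\<bar> < 1"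
    using sheared_grid[OF \<open>k > 0\<close>] .
  have par: "(p + q) $ 2 = (1 - ((p + q) $ 1)\<^sup>2) / 2" and bd: "\<bar>(p + q) $ 1\<bar> < 1"
    if "(p, q) \<in> I" for p q
    using sums that by blast+
  have card: "card P + card Q \<le> n" "card P \<le> n" "card Q \<le> n"
    using PQ(4) k(1) by auto
  have conv: "convexly_independent ((\<lambda>(p, q). p + q) ` I)"
    by (rule convexly_independent_parabola[of _ "1/2" "1/2"])
      (auto simp: par diff_divide_distrib simp del: vector_add_component)
  \<comment> \<open>All sums lie in the open upper half-plane, so no two are antipodal, as
    \<open>W_num_ge\<close> requires.\<close>
  have pos: "(p + q) $ 2 > 0" if "(p, q) \<in> I" for p q
  proof -
    have "((p + q) $ 1)\<^sup>2 < 1"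
      using bd[OF that] by (simp only: abs_square_less_1)
    then show ?thesis
      unfolding par[OF that] by simp
  qed
  have "k ^ 5 \<le> E_num TYPE(2) n"
    using E_num_ge[OF PQ(1-3) card(1) I(1,3) conv] I(2) by simp
  moreover have "k ^ 5 \<le> M_num TYPE(2) n n"
    using M_num_ge[OF PQ(1,2) card(2,3) I(1,3) conv] I(2) by simp
  moreover have "p + q \<noteq> - (r + s)" if "(p, q) \<in> I" "(r, s) \<in> I" for p q r s
    using pos[OF that(1)] pos[OF that(2)] by (metis less_asym neg_0_less_iff_less vector_uminus_component)
  then have "k ^ 5 \<le> W_num TYPE(2) n"
    using W_num_ge[OF PQ(1,2) card(1) I(1,3) strictly_convex_parabolic_norm
        parabolic_norm_eq_1[OF par bd]] I(2) by auto
  moreover have "1/256 * real n * sqrt (ln (real n)) \<le> real (k ^ 5)"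
  proof -
    have "n \<le> 64 * k ^ 4"
    proof -
      have "Suc k ^ 4 \<le> (2 * k) ^ 4"
        using \<open>k > 0\<close> by (intro power_mono) auto
      then show ?thesis
        using k(2) by (simp add: power_mult_distrib)
    qed
    then have nk: "real n \<le> 64 * real k ^ 4"
      using of_nat_le_iff[of n "64 * k ^ 4", where ?'a = real] by simp
    \<comment> \<open>The chain is
      \<open>ln n = 2 * ln (sqrt n) \<le> 2 * sqrt n \<le> 16 * k ^ 2\<close>.\<close>
    have "sqrt (real n) \<le> 8 * real k ^ 2"
      by (rule real_le_lsqrt) (use nk in \<open>simp_all add: power_mult_distrib\<close>)
    moreover have "ln (real n) = 2 * ln (sqrt (real n))"
      using n by (simp add: ln_sqrt)
    moreover have "ln (sqrt (real n)) \<le> sqrt (real n)"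
      using n ln_bound[of "sqrt (real n)"] by simp
    ultimately have "ln (real n) \<le> (4 * real k)\<^sup>2"
      by (simp add: power_mult_distrib)
    then have "sqrt (ln (real n)) \<le> 4 * real k"
      by (intro real_le_lsqrt) auto
    then have "real n * sqrt (ln (real n)) \<le> (64 * real k ^ 4) * (4 * real k)"
      using nk n by (intro mult_mono) auto
    then show ?thesis
      by (simp add: eval_nat_numeral)
  qed
  ultimately show "1/256 * real n * sqrt (ln (real n)) \<le> real (E_num TYPE(2) n)"
    "1/256 * real n * sqrt (ln (real n)) \<le> real (M_num TYPE(2) n n)"
    "1/256 * real n * sqrt (ln (real n)) \<le> real (W_num TYPE(2) n)"
    by (meson of_nat_le_iff order_trans)+
qed

end
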